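(* Let $M/F$ be a Galois field extension of degree $n$ with non-trivial Galois group $G=\mathrm{Gal}(M/F)$, and let $A$ be a $G$-crossed product algebra of degree $n$ over $F$ with maximal subfield $M$. Then $G$ is solvable if there exists a chain of subalgebras $$M=A_0\subset A_1\subset\dots\subset A_k=A$$ of $A$ which all have maximal subfield $M$, and are generalised cyclic algebras $$A_{i+1}\cong A_i[t_i;\tau_i]/A_i[t_i;\tau_i](t_i^{q_i}-c_i)$$ over their centers for all $i\in\{0,\dots,k-1\}$, where $q_i$ is a prime, $\tau_i$ is an $F$-automorphism of $A_i$ of inner order $q_i$ which restricts (on $M$) to an automorphism $\sigma_{i+1}\in G$, and $c_i\in\mathrm{Fix}(\tau_i)^\times$.
   Context: A central simple algebra has degree $n$ over $F$ if it has dimension $n^2$. A $G$-crossed product algebra over $F$ is a central simple $F$-algebra of degree $n$ containing a field extension $M/F$ which is Galois of degree $n$ with Galois group $G$. For a ring $B$ and an automorphism $\tau$ of $B$, $B[t;\tau]$ is the twisted polynomial ring with $tb=\tau(b)t$. For monic $f\in B[t;\tau]$ of degree $q$, $B[t;\tau]/B[t;\tau]f$ denotes the set of polynomials of degree $<q$ with multiplication $g\circ h=$ the remainder of $gh$ after right division by $f$ (the unique $r$ with $\deg r<q$ and $gh=q_1f+r$); $f$ is right invariant if $B[t;\tau]f$ is a two-sided ideal, in which case this is the associative quotient algebra. $\mathrm{Fix}(\tau)=\{b\in B:\tau(b)=b\}$, with $\mathrm{Fix}(\tau)^\times$ its invertible elements. The inner order of an automorphism $\tau$ is the smallest positive integer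 $e$ such that $\tau^e$ is an inner automorphism $x\mapsto uxu^{-1}$ ($u$ a unit). An $F$-automorphism is a ring automorphism fixing $F$ pointwise. Generalised cyclic algebra: for a finite-dimensional central simple algebra $B$ over a field $C$ and $\tau\in\mathrm{Aut}(B)$ such that $\tau|_C$ has finite order $q$, $(B,\tau,c)$ is the associative algebra $B[t;\tau]/B[t;\tau](t^q-c)$ where $c\in\mathrm{Fix}(\tau)^\times$ and $t^q-c$ is right invariant; it is central simple over $C\cap\mathrm{Fix}(\tau)$. *)

theory Defs
  imports
    "HOL-Algebra.Embedded_Algebras"
    "HOL-Algebra.Solvable_Groups"
    "HOL-Algebra.UnivPoly"
    "HOL-Algebra.QuotRing"
    "HOL-Algebra.Bij"
    "HOL-Computational_Algebra.Primes"
begin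

text \<open>
  A unital algebra over a field is a ring together with a central subfield of its carrier.
  A subalgebra \<open>S\<close> of a ring \<open>R\<close>, regarded as a ring in its own right, is
  \<open>R\<lparr>carrier := S\<rparr>\<close>.
\<close>

definition ring_center :: "('a, 'm) ring_scheme \<Rightarrow> 'a set" where
  "ring_center R = {z \<in> carrier R. \<forall>x \<in> carrier R. z \<otimes>\<^bsub>R\<^esub> x = x \<otimes>\<^bsub>R\<^esub> z}"

text \<open>Finite-dimensional central simple algebras; the ring is nonzero because \<open>C\<close> is a field.\<close>

definition central_simple_algebra :: "('a, 'm) ring_scheme \<Rightarrow> 'a set \<Rightarrow> bool" where
  "central_simple_algebra R C \<longleftrightarrow>
     ring R \<and> subfield C R \<and> ring_center R = C \<and>
     (\<exists>d. ring.dimension R d C (carrier R)) \<and>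
     (\<forall>I. ideal I R \<longrightarrow> I = {\<zero>\<^bsub>R\<^esub>} \<or> I = carrier R)"

definition has_degree :: "('a, 'm) ring_scheme \<Rightarrow> 'a set \<Rightarrow> nat \<Rightarrow> bool" where
  "has_degree R C n \<longleftrightarrow> central_simple_algebra R C \<and> ring.dimension R (n\<^sup>2) C (carrier R)"

definition maximal_subfield :: "'a set \<Rightarrow> ('a, 'm) ring_scheme \<Rightarrow> bool" where
  "maximal_subfield M R \<longleftrightarrow>
     subfield M R \<and> (\<forall>L. subfield L R \<and> M \<subseteq> L \<longrightarrow> L = M)"

text \<open>The field \<open>M\<close> and its subfield \<open>F\<close> are subfields of an ambient, possibly
  noncommutative, ring \<open>R\<close>. As in \<^const>\<open>AutoGroup\<close>, automorphisms are extensional on \<open>M\<close>,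
  so that each of them is represented by exactly one function.\<close>

definition Gal :: "('a, 'm) ring_scheme \<Rightarrow> 'a set \<Rightarrow> 'a set \<Rightarrow> ('a \<Rightarrow> 'a) monoid" where
  "Gal R M F = BijGroup M
     \<lparr>carrier := {\<sigma> \<in> Bij M. \<sigma> \<in> ring_iso (R\<lparr>carrier := M\<rparr>) (R\<lparr>carrier := M\<rparr>) \<and>
                            (\<forall>x \<in> F. \<sigma> x = x)}\<rparr>"

definition galois_extension :: "('a, 'm) ring_scheme \<Rightarrow> 'a set \<Rightarrow> 'a set \<Rightarrow> nat \<Rightarrow> bool" where
  "galois_extension R M F n \<longleftrightarrow>
     subfield F R \<and> subfield M R \<and> F \<subseteq> M \<and> ring.dimension R n F M \<and>
     {x \<in> M. \<forall>\<sigma> \<in> carrier (Gal R M F). \<sigma> x = x} = F"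

text \<open>The subfield \<open>M\<close> witnessing the crossed product structure is an argument; the group of
  the crossed product is \<open>Gal R M F\<close>.\<close>

definition crossed_product_algebra ::
  "('a, 'm) ring_scheme \<Rightarrow> 'a set \<Rightarrow> 'a set \<Rightarrow> nat \<Rightarrow> bool" where
  "crossed_product_algebra R M F n \<longleftrightarrow> has_degree R F n \<and> galois_extension R M F n"

text \<open>\<open>B[t;\<tau>]\<close> has the additive structure of the polynomial ring; as \<open>t b = \<tau>(b) t\<close>, the product
  of \<open>a t\<^sup>i\<close> and \<open>b t\<^sup>j\<close> is \<open>a \<tau>\<^sup>i(b) t\<^sup>i\<^sup>+\<^sup>j\<close>.\<close>

definition twisted_poly ::
  "('a, 'm) ring_scheme \<Rightarrow> ('a \<Rightarrow> 'a) \<Rightarrow> ('a, nat \<Rightarrow> 'a) up_ring" where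
  "twisted_poly B \<tau> = UP B
     \<lparr>mult := (\<lambda>p \<in> up B. \<lambda>r \<in> up B. \<lambda>n.
        \<Oplus>\<^bsub>B\<^esub>i \<in> {..n}. p i \<otimes>\<^bsub>B\<^esub> (\<tau> ^^ i) (r (n - i)))\<rparr>"

definition right_invariant ::
  "('a, 'm) ring_scheme \<Rightarrow> ('a \<Rightarrow> 'a) \<Rightarrow> (nat \<Rightarrow> 'a) \<Rightarrow> bool" where
  "right_invariant B \<tau> f \<longleftrightarrow>
     ideal {s \<otimes>\<^bsub>twisted_poly B \<tau>\<^esub> f | s. s \<in> carrier (twisted_poly B \<tau>)} (twisted_poly B \<tau>)"

definition polys_below ::
  "('a, 'm) ring_scheme \<Rightarrow> ('a \<Rightarrow> 'a) \<Rightarrow> nat \<Rightarrow> (nat \<Rightarrow> 'a) set" where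
  "polys_below B \<tau> q =
     {p \<in> carrier (twisted_poly B \<tau>). \<forall>i \<ge> q. coeff (twisted_poly B \<tau>) p i = \<zero>\<^bsub>B\<^esub>}"

text \<open>The remainder is unique if \<open>f\<close> is monic of degree \<open>q\<close> and \<open>\<tau>\<close> is an automorphism
  of \<open>B\<close>.\<close>

definition right_rem ::
  "('a, 'm) ring_scheme \<Rightarrow> ('a \<Rightarrow> 'a) \<Rightarrow> (nat \<Rightarrow> 'a) \<Rightarrow> nat \<Rightarrow> (nat \<Rightarrow> 'a) \<Rightarrow> (nat \<Rightarrow> 'a)" where
  "right_rem B \<tau> f q g = (THE r. r \<in> polys_below B \<tau> q \<and>
     (\<exists>s \<in> carrier (twisted_poly B \<tau>).
        g = s \<otimes>\<^bsub>twisted_poly B \<tau>\<^esub> f \<oplus>\<^bsub>twisted_poly B \<tau>\<^esub> r))"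

text \<open>\<open>B[t;\<tau>]/B[t;\<tau>]f\<close> for \<open>f\<close> monic of degree \<open>q > 0\<close>.\<close>

definition twisted_quotient ::
  "('a, 'm) ring_scheme \<Rightarrow> ('a \<Rightarrow> 'a) \<Rightarrow> (nat \<Rightarrow> 'a) \<Rightarrow> nat \<Rightarrow> ('a, nat \<Rightarrow> 'a) up_ring" where
  "twisted_quotient B \<tau> f q = twisted_poly B \<tau>
     \<lparr>carrier := polys_below B \<tau> q,
      mult := (\<lambda>g h. right_rem B \<tau> f q (g \<otimes>\<^bsub>twisted_poly B \<tau>\<^esub> h))\<rparr>"

definition binomial_poly ::
  "('a, 'm) ring_scheme \<Rightarrow> ('a \<Rightarrow> 'a) \<Rightarrow> nat \<Rightarrow> 'a \<Rightarrow> (nat \<Rightarrow> 'a)" where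
  "binomial_poly B \<tau> q c =
     monom (twisted_poly B \<tau>) \<one>\<^bsub>B\<^esub> q \<ominus>\<^bsub>twisted_poly B \<tau>\<^esub> monom (twisted_poly B \<tau>) c 0"

definition Fix :: "('a, 'm) ring_scheme \<Rightarrow> ('a \<Rightarrow> 'a) \<Rightarrow> 'a set" where
  "Fix B \<tau> = {b \<in> carrier B. \<tau> b = b}"

definition inner_automorphism :: "('a, 'm) ring_scheme \<Rightarrow> ('a \<Rightarrow> 'a) \<Rightarrow> bool" where
  "inner_automorphism B \<rho> \<longleftrightarrow>
     (\<exists>u \<in> Units B. \<forall>x \<in> carrier B. \<rho> x = u \<otimes>\<^bsub>B\<^esub> x \<otimes>\<^bsub>B\<^esub> inv\<^bsub>B\<^esub> u)"

definition has_inner_order :: "('a, 'm) ring_scheme \<Rightarrow> ('a \<Rightarrow> 'a) \<Rightarrow> nat \<Rightarrow> bool" where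
  "has_inner_order B \<tau> e \<longleftrightarrow>
     0 < e \<and> inner_automorphism B (\<tau> ^^ e) \<and>
     (\<forall>d. 0 < d \<and> d < e \<longrightarrow> \<not> inner_automorphism B (\<tau> ^^ d))"

definition has_order_on :: "'a set \<Rightarrow> ('a \<Rightarrow> 'a) \<Rightarrow> nat \<Rightarrow> bool" where
  "has_order_on C \<tau> e \<longleftrightarrow>
     0 < e \<and> (\<forall>x \<in> C. (\<tau> ^^ e) x = x) \<and>
     (\<forall>d. 0 < d \<and> d < e \<longrightarrow> (\<exists>x \<in> C. (\<tau> ^^ d) x \<noteq> x))"

text \<open>The conditions on \<open>B\<close>, \<open>\<tau>\<close>, \<open>q\<close>, \<open>c\<close> under which \<open>(B, \<tau>, c)\<close> is defined, and that
  algebra. The base field of \<open>B\<close> is its center.\<close>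

definition generalised_cyclic_data ::
  "('a, 'm) ring_scheme \<Rightarrow> ('a \<Rightarrow> 'a) \<Rightarrow> nat \<Rightarrow> 'a \<Rightarrow> bool" where
  "generalised_cyclic_data B \<tau> q c \<longleftrightarrow>
     central_simple_algebra B (ring_center B) \<and>
     \<tau> \<in> ring_iso B B \<and>
     has_order_on (ring_center B) \<tau> q \<and>
     c \<in> Units (B\<lparr>carrier := Fix B \<tau>\<rparr>) \<and>
     right_invariant B \<tau> (binomial_poly B \<tau> q c)"

definition generalised_cyclic_algebra ::
  "('a, 'm) ring_scheme \<Rightarrow> ('a \<Rightarrow> 'a) \<Rightarrow> nat \<Rightarrow> 'a \<Rightarrow> ('a, nat \<Rightarrow> 'a) up_ring" where
  "generalised_cyclic_algebra B \<tau> q c = twisted_quotient B \<tau> (binomial_poly B \<tau> q c) q"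

text \<open>\<open>F\<close> is embedded in the left-hand side via constant polynomials.\<close>

definition gca_isomorphic_over ::
  "'a set \<Rightarrow> ('a, 'm) ring_scheme \<Rightarrow> ('a \<Rightarrow> 'a) \<Rightarrow> nat \<Rightarrow> 'a \<Rightarrow> ('a, 'k) ring_scheme \<Rightarrow> bool" where
  "gca_isomorphic_over F B \<tau> q c R \<longleftrightarrow>
     (\<exists>\<phi> \<in> ring_iso (generalised_cyclic_algebra B \<tau> q c) R.
        \<forall>a \<in> F. \<phi> (monom (twisted_poly B \<tau>) a 0) = a)"

end

theory Submission
  imports Defs
begin

text \<open>
  Write \<open>Z\<^sub>i\<close> for the center of \<open>A\<^sub>i\<close>. Up to isomorphism, the centers shrink by one cyclic step at a time, from
  \<open>Z\<^sub>0 = M\<close> to \<open>Z\<^sub>k = F\<close>: the center of \<open>A\<^sub>i[t; \<tau>\<^sub>i]/(t\<^sup>q - c)\<close> consists of the constants from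
  \<open>Z\<^sub>i\<close> that \<open>\<tau>\<^sub>i\<close> fixes (lemma \<open>center_of_gca_copy\<close>), and \<open>\<tau>\<^sub>i\<close> acts on \<open>Z\<^sub>i\<close> with finite
  order. Going down this tower of fixed fields, each Galois group contains the previous one as the
  kernel of the restriction to a cyclic extension, so that solvability is inherited at each step.

  The isomorphism of \<open>A\<^sub>i[t; \<tau>\<^sub>i]/(t\<^sup>q - c)\<close> with \<open>A\<^sub>i\<^sub>+\<^sub>1\<close> fixes \<open>F\<close>, but it may move
  \<open>A\<^sub>i\<close> to another subring of \<open>A\<^sub>i\<^sub>+\<^sub>1\<close>. So \<open>Z\<^sub>i\<^sub>+\<^sub>1\<close> is only isomorphic over \<open>F\<close> to the
  fixed field of \<open>\<tau>\<^sub>i\<close> in \<open>Z\<^sub>i\<close>. The induction therefore does not compare the centers as subsets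
  of \<open>M\<close>. It maintains an embedding \<open>\<theta>\<^sub>i\<close> of \<open>Z\<^sub>i\<close> into \<open>M\<close> over \<open>F\<close> such that the group of
  \<open>M\<close> over \<open>\<theta>\<^sub>i(Z\<^sub>i)\<close> is solvable (lemma \<open>center_embedding_step\<close>). At the end
  \<open>\<theta>\<^sub>k(Z\<^sub>k) = F\<close>.

  For the inductive step let \<open>h\<close> be an automorphism of \<open>M\<close> that fixes the image under \<open>\<theta>\<^sub>i\<close> of
  the fixed field of \<open>\<tau>\<^sub>i\<close>. Then \<open>h\<close> fixes the traces \<open>\<Sum>\<^sub>j \<theta>\<^sub>i(\<tau>\<^sub>i\<^sup>j(z))\<close>, where \<open>j\<close> is
  less than the order of \<open>\<tau>\<^sub>i\<close>. Dedekind's independence of characters turns this identity into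
  \<open>h \<circ> \<theta>\<^sub>i = \<theta>\<^sub>i \<circ> \<tau>\<^sub>i\<^sup>m\<close> for some \<open>m\<close>
  (lemma \<open>homs_agreeing_on_fixed_points_differ_by_power\<close>). Two such \<open>h\<close> commute on
  \<open>\<theta>\<^sub>i(Z\<^sub>i)\<close>, hence the derived subgroup of the larger Galois group lies in the smaller one.
\<close>

section \<open>Twisted polynomials\<close>

lemma ring_hom_funpow:
  assumes "\<sigma> \<in> ring_hom R R"
  shows "\<sigma> ^^ j \<in> ring_hom R R"
proof (induction j)
  case 0
  then show ?case by (simp add: ring_hom_memI)
next
  case (Suc j)
  then show ?case using ring_hom_trans[OF Suc assms] by (simp add: comp_def)
qed

lemma ring_iso_image_center:
  assumes \<phi>: "\<phi> \<in> ring_iso Q R"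
  shows "\<phi> ` ring_center Q \<subseteq> ring_center R"
proof -
  note E = ring_iso_memE[OF \<phi>]
  have surj: "carrier R = \<phi> ` carrier Q"
    using E(5) by (simp add: bij_betw_def)
  then show ?thesis
    unfolding ring_center_def by (auto simp: E(2)[symmetric])
qed

locale skew_polynomials = ring B for B (structure) +
  fixes \<tau> :: "'a \<Rightarrow> 'a"
  assumes hom: "\<tau> \<in> ring_hom B B"
begin

abbreviation "P \<equiv> twisted_poly B \<tau>"

lemmas funpow_hom = ring_hom_funpow[OF hom]

lemma funpow_closed [simp]: "b \<in> carrier B \<Longrightarrow> (\<tau> ^^ i) b \<in> carrier B"
  using ring_hom_memE(1)[OF funpow_hom] .

lemma funpow_zero [simp]: "(\<tau> ^^ i) \<zero> = \<zero>"
  using ring_hom_zero[OF funpow_hom ring_axioms ring_axioms] .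

lemma funpow_one [simp]: "(\<tau> ^^ i) \<one> = \<one>"
  using ring_hom_memE(4)[OF funpow_hom] .

lemma carrier_poly: "carrier P = up B"
  by (simp add: twisted_poly_def UP_def)

lemma coeff_poly: "p \<in> up B \<Longrightarrow> coeff P p i = p i"
  by (simp add: twisted_poly_def UP_def)

lemma add_poly: "p \<in> up B \<Longrightarrow> r \<in> up B \<Longrightarrow> p \<oplus>\<^bsub>P\<^esub> r = (\<lambda>i. p i \<oplus> r i)"
  by (simp add: twisted_poly_def UP_def)

lemma mult_poly:
  "p \<in> up B \<Longrightarrow> r \<in> up B \<Longrightarrow> p \<otimes>\<^bsub>P\<^esub> r = (\<lambda>n. \<Oplus>i\<in>{..n}. p i \<otimes> (\<tau> ^^ i) (r (n - i)))"
  by (simp add: twisted_poly_def UP_def)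

lemma monom_poly: "a \<in> carrier B \<Longrightarrow> monom P a n = (\<lambda>i. if i = n then a else \<zero>)"
  by (simp add: twisted_poly_def UP_def)

lemma monom_in_up: "a \<in> carrier B \<Longrightarrow> monom P a n \<in> up B"
  by (auto simp: monom_poly up_def)

lemma one_poly: "\<one>\<^bsub>P\<^esub> = monom P \<one> 0"
  by (simp add: twisted_poly_def UP_def)

lemma binomial_poly_eq:
  assumes c: "c \<in> carrier B"
  shows "binomial_poly B \<tau> q c \<in> up B"
    and "binomial_poly B \<tau> q c n = (if n = q then \<one> else \<zero>) \<ominus> (if n = 0 then c else \<zero>)"
proof -
  have coeff_UP: "coeff (UP B) p n = p n" if "p \<in> up B" for p
    using that by (simp add: UP_def)
  have carrier_UP: "carrier (UP B) = up B"
    by (simp add: UP_def)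
  have mon: "monom P a m = monom (UP B) a m" for a m
    by (simp add: twisted_poly_def UP_def)
  interpret U: UP_ring B "UP B" by (unfold_locales)
  have eq: "binomial_poly B \<tau> q c = monom (UP B) \<one> q \<ominus>\<^bsub>UP B\<^esub> monom (UP B) c 0"
    unfolding binomial_poly_def mon a_minus_def
    by (simp add: a_inv_def twisted_poly_def)
  have cl: "binomial_poly B \<tau> q c \<in> carrier (UP B)"
    unfolding eq using c by simp
  then show up: "binomial_poly B \<tau> q c \<in> up B"
    by (simp only: carrier_UP)
  have "binomial_poly B \<tau> q c n = coeff (UP B) (binomial_poly B \<tau> q c) n"
    by (rule coeff_UP[OF up, symmetric])
  also have "\<dots> = (if n = q then \<one> else \<zero>) \<ominus> (if n = 0 then c else \<zero>)"
    unfolding eq using c by (auto simp: U.coeff_minus)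
  finally show "binomial_poly B \<tau> q c n = (if n = q then \<one> else \<zero>) \<ominus> (if n = 0 then c else \<zero>)" .
qed

lemma polys_below_eq: "polys_below B \<tau> q = {p \<in> up B. \<forall>i\<ge>q. p i = \<zero>}"
  by (auto simp: polys_below_def carrier_poly coeff_poly)

lemma mult_term_closed:
  "p \<in> up B \<Longrightarrow> r \<in> up B \<Longrightarrow> p i \<otimes> (\<tau> ^^ i) (r j) \<in> carrier B"
  by (simp add: mem_upD)

text \<open>
  As \<^term>\<open>\<tau>\<close> fixes \<^term>\<open>\<one>\<close>, multiplying by a monic polynomial of degree \<open>q\<close> on the right moves
  the leading coefficient up by \<open>q\<close> places without changing it, whatever the leading coefficient
  of the left factor is. Zero divisors in the coefficient ring therefore do no harm.
\<close>

lemma monic_mult_degree: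
  assumes s: "s \<in> up B" and f: "f \<in> up B" and lead: "f q = \<one>"
    and above: "\<And>i. q < i \<Longrightarrow> f i = \<zero>"
    and low: "\<And>n. q \<le> n \<Longrightarrow> (s \<otimes>\<^bsub>P\<^esub> f) n = \<zero>"
  shows "s = (\<lambda>_. \<zero>)"
proof (rule ccontr)
  assume "s \<noteq> (\<lambda>_. \<zero>)"
  then have ne: "{i. s i \<noteq> \<zero>} \<noteq> {}"
    by auto
  obtain N where "bound \<zero> N s"
    using bound_upD[OF s] by blast
  then have "{i. s i \<noteq> \<zero>} \<subseteq> {..N}"
    using bound_below[of \<zero> N s] by blast
  then have fin: "finite {i. s i \<noteq> \<zero>}"
    by (rule finite_subset) simp
  define d where "d = Max {i. s i \<noteq> \<zero>}"
  have sd: "s d \<noteq> \<zero>"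
    using Max_in[OF fin ne] by (simp add: d_def)
  have top: "s i = \<zero>" if "d < i" for i
    using Max_ge[OF fin, of i] that by (force simp: d_def)
  have "(s \<otimes>\<^bsub>P\<^esub> f) (d + q) = (\<Oplus>i\<in>{..d + q}. s i \<otimes> (\<tau> ^^ i) (f (d + q - i)))"
    using s f by (simp add: mult_poly)
  also have "\<dots> = (\<Oplus>i\<in>{..d + q}. if d = i then s i else \<zero>)"
  proof (rule finsum_cong')
    fix i assume "i \<in> {..d + q}"
    show "s i \<otimes> (\<tau> ^^ i) (f (d + q - i)) = (if d = i then s i else \<zero>)"
    proof (cases i d rule: linorder_cases)
      case less
      then show ?thesis using above[of "d + q - i"] mem_upD[OF s] by simp
    next
      case equal
      then show ?thesis using lead mem_upD[OF s] by simp
    next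
      case greater
      then show ?thesis using top mem_upD[OF f] by simp
    qed
  qed (use s mem_upD in auto)
  also have "\<dots> = s d"
    using s by (intro finsum_singleton) (auto simp: mem_upD)
  finally show False
    using low[of "d + q"] sd by simp
qed

text \<open>
  Commutation in a twisted quotient will only be tested on products whose degree is below \<open>q\<close>. There
  the quotient multiplies as the twisted polynomial ring does. The remainder of such a product is
  the product itself, and it is the only one because a nonzero multiple of a monic polynomial of
  degree \<open>q\<close> has a nonzero coefficient in some degree \<open>\<ge> q\<close>.
\<close>

lemma right_rem_low_degree:
  assumes f: "f \<in> up B" and lead: "f q = \<one>" and above: "\<And>i. q < i \<Longrightarrow> f i = \<zero>"
    and p: "p \<in> polys_below B \<tau> q"
  shows "right_rem B \<tau> f q p = p"
  unfolding right_rem_def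
proof (rule the_equality)
  have zero_up: "(\<lambda>_. \<zero>) \<in> up B"
    by auto
  have zero_mult: "(\<lambda>_. \<zero>) \<otimes>\<^bsub>P\<^esub> f = (\<lambda>_. \<zero>)"
    using f zero_up by (simp add: mult_poly mem_upD)
  have pu: "p \<in> up B"
    using p by (simp add: polys_below_eq)
  have "p = (\<lambda>_. \<zero>) \<otimes>\<^bsub>P\<^esub> f \<oplus>\<^bsub>P\<^esub> p"
    using pu zero_up by (simp add: zero_mult add_poly mem_upD)
  then show "p \<in> polys_below B \<tau> q \<and> (\<exists>s\<in>carrier P. p = s \<otimes>\<^bsub>P\<^esub> f \<oplus>\<^bsub>P\<^esub> p)"
    using p zero_up by (auto simp: carrier_poly)
  fix r assume "r \<in> polys_below B \<tau> q \<and> (\<exists>s\<in>carrier P. p = s \<otimes>\<^bsub>P\<^esub> f \<oplus>\<^bsub>P\<^esub> r)"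
  then obtain s where r: "r \<in> polys_below B \<tau> q" and s: "s \<in> up B"
    and eq: "p = s \<otimes>\<^bsub>P\<^esub> f \<oplus>\<^bsub>P\<^esub> r"
    by (auto simp: carrier_poly)
  have ru: "r \<in> up B"
    using r by (simp add: polys_below_eq)
  have sf_closed: "(s \<otimes>\<^bsub>P\<^esub> f) n \<in> carrier B" for n
    using s f by (simp add: mult_poly mult_term_closed)
  have sf: "s \<otimes>\<^bsub>P\<^esub> f \<in> up B"
  proof -
    obtain N where N: "bound \<zero> N s" using bound_upD[OF s] by blast
    have "bound \<zero> (N + q) (s \<otimes>\<^bsub>P\<^esub> f)"
    proof
      fix n assume n: "N + q < n"
      have "s i \<otimes> (\<tau> ^^ i) (f (n - i)) = \<zero>" for i
      proof (cases "N < i")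
        case True
        then show ?thesis using N mem_upD[OF f] by (simp add: bound.bound)
      next
        case False
        then show ?thesis using n above[of "n - i"] mem_upD[OF s] by simp
      qed
      then show "(s \<otimes>\<^bsub>P\<^esub> f) n = \<zero>"
        using s f by (simp add: mult_poly)
    qed
    then show ?thesis using sf_closed by auto
  qed
  have coeffs: "p n = (s \<otimes>\<^bsub>P\<^esub> f) n \<oplus> r n" for n
    using eq sf ru by (metis add_poly)
  have "s = (\<lambda>_. \<zero>)"
  proof (rule monic_mult_degree[OF s f lead above])
    fix n assume "q \<le> n"
    then show "(s \<otimes>\<^bsub>P\<^esub> f) n = \<zero>"
      using coeffs[of n] p r sf_closed[of n] by (simp add: polys_below_eq)
  qed
  then show "r = p"
    using eq zero_mult zero_up ru by (simp add: add_poly mem_upD)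
qed

section \<open>The center of a generalised cyclic algebra\<close>

lemma carrier_gca: "carrier (generalised_cyclic_algebra B \<tau> q c) = polys_below B \<tau> q"
  by (simp add: generalised_cyclic_algebra_def twisted_quotient_def)

lemma add_gca: "x \<oplus>\<^bsub>generalised_cyclic_algebra B \<tau> q c\<^esub> y = x \<oplus>\<^bsub>P\<^esub> y"
  by (simp add: generalised_cyclic_algebra_def twisted_quotient_def)

lemma one_gca: "\<one>\<^bsub>generalised_cyclic_algebra B \<tau> q c\<^esub> = monom P \<one> 0"
  by (simp add: generalised_cyclic_algebra_def twisted_quotient_def one_poly)

lemma mult_gca_low_degree:
  assumes "0 < q" "c \<in> carrier B" "x \<otimes>\<^bsub>P\<^esub> y \<in> polys_below B \<tau> q"
  shows "x \<otimes>\<^bsub>generalised_cyclic_algebra B \<tau> q c\<^esub> y = x \<otimes>\<^bsub>P\<^esub> y"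
proof -
  have "right_rem B \<tau> (binomial_poly B \<tau> q c) q (x \<otimes>\<^bsub>P\<^esub> y) = x \<otimes>\<^bsub>P\<^esub> y"
    using assms by (intro right_rem_low_degree binomial_poly_eq(1))
      (auto simp: binomial_poly_eq(2) a_minus_def)
  then show ?thesis
    by (simp add: generalised_cyclic_algebra_def twisted_quotient_def)
qed

lemma mult_const_right:
  assumes p: "p \<in> up B" and b: "b \<in> carrier B"
  shows "p \<otimes>\<^bsub>P\<^esub> monom P b 0 = (\<lambda>n. p n \<otimes> (\<tau> ^^ n) b)"
proof
  fix n
  have "(p \<otimes>\<^bsub>P\<^esub> monom P b 0) n = (\<Oplus>i\<in>{..n}. p i \<otimes> (\<tau> ^^ i) (monom P b 0 (n - i)))"
    using p monom_in_up[OF b] by (simp add: mult_poly)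
  also have "\<dots> = (\<Oplus>i\<in>{..n}. if n = i then p i \<otimes> (\<tau> ^^ i) b else \<zero>)"
    using p b by (intro finsum_cong') (auto simp: monom_poly mem_upD)
  also have "\<dots> = p n \<otimes> (\<tau> ^^ n) b"
    using p b by (intro finsum_singleton) (auto simp: mem_upD)
  finally show "(p \<otimes>\<^bsub>P\<^esub> monom P b 0) n = p n \<otimes> (\<tau> ^^ n) b" .
qed

lemma mult_monom_left:
  assumes p: "p \<in> up B" and b: "b \<in> carrier B"
  shows "monom P b m \<otimes>\<^bsub>P\<^esub> p = (\<lambda>n. if m \<le> n then b \<otimes> (\<tau> ^^ m) (p (n - m)) else \<zero>)"
proof
  fix n
  have "(monom P b m \<otimes>\<^bsub>P\<^esub> p) n = (\<Oplus>i\<in>{..n}. monom P b m i \<otimes> (\<tau> ^^ i) (p (n - i)))"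
    using p monom_in_up[OF b] by (simp add: mult_poly)
  also have "\<dots> = (\<Oplus>i\<in>{..n}. if m = i then b \<otimes> (\<tau> ^^ i) (p (n - i)) else \<zero>)"
    using p b by (intro finsum_cong') (auto simp: monom_poly mem_upD)
  also have "\<dots> = (if m \<le> n then b \<otimes> (\<tau> ^^ m) (p (n - m)) else \<zero>)"
  proof (cases "m \<le> n")
    case True
    then show ?thesis
      using p b finsum_singleton[of m "{..n}" "\<lambda>i. b \<otimes> (\<tau> ^^ i) (p (n - i))"]
      by (simp add: mem_upD)
  next
    case False
    then have "(\<Oplus>i\<in>{..n}. if m = i then b \<otimes> (\<tau> ^^ i) (p (n - i)) else \<zero>) = (\<Oplus>i\<in>{..n}. \<zero>)"
      by (intro finsum_cong') auto
    then show ?thesis using False by simp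
  qed
  finally show "(monom P b m \<otimes>\<^bsub>P\<^esub> p) n = (if m \<le> n then b \<otimes> (\<tau> ^^ m) (p (n - m)) else \<zero>)" .
qed

lemma monom_below: "a \<in> carrier B \<Longrightarrow> m < q \<Longrightarrow> monom P a m \<in> polys_below B \<tau> q"
  using monom_in_up by (simp add: polys_below_eq monom_poly)

lemma const_mult_gca:
  assumes "0 < q" "c \<in> carrier B" and b: "b \<in> carrier B" and p: "p \<in> polys_below B \<tau> q"
  shows "monom P b 0 \<otimes>\<^bsub>generalised_cyclic_algebra B \<tau> q c\<^esub> p = (\<lambda>n. b \<otimes> p n)"
    and "p \<otimes>\<^bsub>generalised_cyclic_algebra B \<tau> q c\<^esub> monom P b 0 = (\<lambda>n. p n \<otimes> (\<tau> ^^ n) b)"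
    and "(\<lambda>n. b \<otimes> p n) \<in> polys_below B \<tau> q"
    and "(\<lambda>n. p n \<otimes> (\<tau> ^^ n) b) \<in> polys_below B \<tau> q"
proof -
  have pu: "p \<in> up B" and low: "\<And>i. q \<le> i \<Longrightarrow> p i = \<zero>"
    using p by (auto simp: polys_below_eq)
  have below: "g \<in> polys_below B \<tau> q"
    if "\<And>n. g n \<in> carrier B" "\<And>n. q \<le> n \<Longrightarrow> g n = \<zero>" for g
    using that unfolding polys_below_eq by (auto intro!: mem_upI exI[of _ q] bound.intro)
  have left: "monom P b 0 \<otimes>\<^bsub>P\<^esub> p = (\<lambda>n. b \<otimes> p n)"
    by (simp add: mult_monom_left[OF pu b])
  show left_below: "(\<lambda>n. b \<otimes> p n) \<in> polys_below B \<tau> q"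
    using b pu low by (intro below) (auto simp: mem_upD)
  show "monom P b 0 \<otimes>\<^bsub>generalised_cyclic_algebra B \<tau> q c\<^esub> p = (\<lambda>n. b \<otimes> p n)"
    using mult_gca_low_degree assms(1,2) left left_below by simp
  show right_below: "(\<lambda>n. p n \<otimes> (\<tau> ^^ n) b) \<in> polys_below B \<tau> q"
    using b pu low by (intro below) (auto simp: mem_upD)
  show "p \<otimes>\<^bsub>generalised_cyclic_algebra B \<tau> q c\<^esub> monom P b 0 = (\<lambda>n. p n \<otimes> (\<tau> ^^ n) b)"
    using mult_gca_low_degree assms(1,2) mult_const_right[OF pu b] right_below by simp
qed

text \<open>
  An element \<open>p\<close> with coefficients \<open>p\<^sub>n\<close> commutes with a constant \<open>b\<close> exactly if
  \<open>p\<^sub>n \<tau>\<^sup>n(b) = b p\<^sub>n\<close> for all \<open>n\<close>. For central \<open>b\<close> this says that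
  \<open>p\<^sub>n (\<tau>\<^sup>n(b) - b) = 0\<close>, and for \<open>0 < n < q\<close> some central \<open>b\<close> makes the second factor a
  nonzero element of the field \<^term>\<open>ring_center B\<close>, whence \<open>p\<^sub>n = 0\<close>. Thus \<open>p\<close> is a central
  constant, and commuting with \<open>t\<close> puts it into the fixed ring of \<^term>\<open>\<tau>\<close>.

  The center is computed in an isomorphic copy \<open>R\<close>: transporting an identity back from \<open>R\<close> uses
  injectivity of \<^term>\<open>\<phi>\<close> only at products known to have low degree.
\<close>

lemma center_of_gca_copy:
  assumes q: "1 < q" and c: "c \<in> carrier B" and Z: "subfield (ring_center B) B"
    and stable: "\<tau> ` ring_center B \<subseteq> ring_center B"
    and ord: "has_order_on (ring_center B) \<tau> q"
    and \<phi>: "\<phi> \<in> ring_iso (generalised_cyclic_algebra B \<tau> q c) R"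
  shows "ring_center R = (\<lambda>z. \<phi> (monom P z 0)) ` (ring_center B \<inter> Fix B \<tau>)"
proof (intro equalityI subsetI)
  let ?Q = "generalised_cyclic_algebra B \<tau> q c"
  note E = ring_iso_memE[OF \<phi>, unfolded carrier_gca]
  fix r assume r: "r \<in> ring_center R"
  then obtain p where p: "p \<in> polys_below B \<tau> q" and rp: "r = \<phi> p"
    using E(5) by (auto simp: ring_center_def bij_betw_def)
  have comm: "p \<otimes>\<^bsub>?Q\<^esub> x = x \<otimes>\<^bsub>?Q\<^esub> p" if x: "x \<in> polys_below B \<tau> q"
    and low: "p \<otimes>\<^bsub>?Q\<^esub> x \<in> polys_below B \<tau> q" "x \<otimes>\<^bsub>?Q\<^esub> p \<in> polys_below B \<tau> q" for x
  proof -
    have "\<phi> (p \<otimes>\<^bsub>?Q\<^esub> x) = \<phi> (x \<otimes>\<^bsub>?Q\<^esub> p)"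
      using r rp p x E(1,2) by (simp add: ring_center_def)
    then show ?thesis
      using E(5) low by (meson bij_betw_imp_inj_on inj_onD)
  qed
  have pu: "p \<in> up B" and low: "\<And>i. q \<le> i \<Longrightarrow> p i = \<zero>"
    using p by (auto simp: polys_below_eq)
  have pn: "p n \<otimes> (\<tau> ^^ n) b = b \<otimes> p n" if b: "b \<in> carrier B" for b n
  proof -
    have "(\<lambda>n. p n \<otimes> (\<tau> ^^ n) b) = (\<lambda>n. b \<otimes> p n)"
      using comm[OF monom_below[OF b, of 0]] q const_mult_gca[OF _ c b p] by simp
    then show ?thesis by (rule fun_cong)
  qed
  have higher: "p n = \<zero>" if nz: "n \<noteq> 0" for n
  proof (cases "q \<le> n")
    case False
    then obtain z where z: "z \<in> ring_center B" "(\<tau> ^^ n) z \<noteq> z"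
      using ord nz unfolding has_order_on_def by auto
    have tz: "(\<tau> ^^ m) z \<in> ring_center B" for m
      using z(1) stable by (induction m) auto
    let ?d = "(\<tau> ^^ n) z \<ominus> z"
    have carr: "z \<in> carrier B" "(\<tau> ^^ n) z \<in> carrier B"
      using z(1) tz by (auto simp: ring_center_def)
    have "?d \<in> ring_center B"
      using tz[of n] z(1) subringE(5,7)[OF subfieldE(1)[OF Z]] by (simp add: a_minus_def)
    moreover have "?d \<noteq> \<zero>"
      using z carr by simp
    ultimately have unit: "?d \<in> Units B"
      using subfield_m_inv[OF Z, of ?d] subfieldE(3)[OF Z] carr by (auto simp: Units_def)
    have "p n \<otimes> (\<tau> ^^ n) z = p n \<otimes> z"
      using pn[OF carr(1), of n] z(1) mem_upD[OF pu] by (simp add: ring_center_def)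
    then have "p n \<otimes> ?d = \<zero>"
      using carr mem_upD[OF pu, of n] by (simp add: a_minus_def r_distr r_minus r_neg)
    then have "p n \<otimes> ?d \<otimes> inv ?d = \<zero>"
      using unit by simp
    then show ?thesis
      using unit mem_upD[OF pu, of n] by (simp add: m_assoc Units_closed)
  qed (simp add: low)
  have p0: "p 0 \<in> carrier B"
    using mem_upD[OF pu] .
  then have p_eq: "p = monom P (p 0) 0"
    using higher by (auto simp: monom_poly)
  have "p 0 \<in> ring_center B"
    using pn[of _ 0] p0 by (simp add: ring_center_def)
  moreover have "\<tau> (p 0) = p 0"
  proof -
    \<comment> \<open>The indeterminate has degree below \<open>q\<close> because \<open>1 < q\<close>.\<close>
    let ?t = "monom P \<one> 1"
    have t: "?t \<in> polys_below B \<tau> q"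
      using monom_below q by simp
    have pt: "p \<otimes>\<^bsub>?Q\<^esub> ?t = (\<lambda>n. p 0 \<otimes> ?t n)"
      using const_mult_gca(1)[OF _ c p0 t] q p_eq by auto
    have tp: "?t \<otimes>\<^bsub>?Q\<^esub> p = (\<lambda>n. ?t n \<otimes> (\<tau> ^^ n) (p 0))"
      using const_mult_gca(2)[OF _ c p0 t] q p_eq by auto
    have "p \<otimes>\<^bsub>?Q\<^esub> ?t = ?t \<otimes>\<^bsub>?Q\<^esub> p"
      using comm[OF t] const_mult_gca(3,4)[OF _ c p0 t] q unfolding pt tp by simp
    then have "(\<lambda>n. p 0 \<otimes> ?t n) = (\<lambda>n. ?t n \<otimes> (\<tau> ^^ n) (p 0))"
      unfolding pt tp .
    then have "p 0 \<otimes> ?t 1 = ?t 1 \<otimes> (\<tau> ^^ 1) (p 0)"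
      by (rule fun_cong)
    then show ?thesis
      using p0 ring_hom_memE(1)[OF hom p0] by (simp add: monom_poly)
  qed
  ultimately have "p 0 \<in> ring_center B \<inter> Fix B \<tau>"
    using p0 by (auto simp: Fix_def)
  then show "r \<in> (\<lambda>z. \<phi> (monom P z 0)) ` (ring_center B \<inter> Fix B \<tau>)"
    using p_eq rp by (intro image_eqI[of _ _ "p 0"]) auto
next
  let ?Q = "generalised_cyclic_algebra B \<tau> q c"
  note E = ring_iso_memE[OF \<phi>, unfolded carrier_gca]
  fix r assume "r \<in> (\<lambda>z. \<phi> (monom P z 0)) ` (ring_center B \<inter> Fix B \<tau>)"
  then obtain z where z: "z \<in> ring_center B" "\<tau> z = z" "z \<in> carrier B"
    and r: "r = \<phi> (monom P z 0)"
    by (auto simp: Fix_def)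
  have fixn: "(\<tau> ^^ n) z = z" for n
    using z(2) by (induction n) auto
  have zP: "monom P z 0 \<in> polys_below B \<tau> q"
    using z(3) q monom_below by simp
  have "\<phi> (monom P z 0) \<otimes>\<^bsub>R\<^esub> \<phi> x = \<phi> x \<otimes>\<^bsub>R\<^esub> \<phi> (monom P z 0)"
    if x: "x \<in> polys_below B \<tau> q" for x
  proof -
    have "x n \<in> carrier B" for n
      using x by (auto simp: polys_below_eq)
    then have "monom P z 0 \<otimes>\<^bsub>?Q\<^esub> x = x \<otimes>\<^bsub>?Q\<^esub> monom P z 0"
      using z(1) const_mult_gca(1,2)[OF _ c z(3) x] q fixn by (simp add: ring_center_def)
    then show ?thesis
      using E(2) zP x by metis
  qed
  moreover have "carrier R = \<phi> ` polys_below B \<tau> q"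
    using E(5) by (simp add: bij_betw_def)
  ultimately show "r \<in> ring_center R"
    unfolding ring_center_def r using E(1) zP by auto
qed

lemma central_fixed_points_iso_center:
  assumes q: "1 < q" and c: "c \<in> carrier B" and Z: "subfield (ring_center B) B"
    and stable: "\<tau> ` ring_center B \<subseteq> ring_center B"
    and ord: "has_order_on (ring_center B) \<tau> q"
    and \<phi>: "\<phi> \<in> ring_iso (generalised_cyclic_algebra B \<tau> q c) R"
  shows "(\<lambda>z. \<phi> (monom P z 0)) \<in>
           ring_iso (B\<lparr>carrier := ring_center B \<inter> Fix B \<tau>\<rparr>) (R\<lparr>carrier := ring_center R\<rparr>)"
proof -
  let ?Q = "generalised_cyclic_algebra B \<tau> q c"
  let ?W = "ring_center B \<inter> Fix B \<tau>"
  note E = ring_iso_memE[OF \<phi>]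
  have W: "z \<in> carrier B" "\<tau> z = z" if "z \<in> ?W" for z
    using that by (auto simp: Fix_def)
  have below: "monom P z 0 \<in> carrier ?Q" if "z \<in> carrier B" for z
    using that q monom_below by (simp add: carrier_gca)
  have mult: "monom P (z \<otimes> w) 0 = monom P z 0 \<otimes>\<^bsub>?Q\<^esub> monom P w 0"
    if z: "z \<in> carrier B" and w: "w \<in> carrier B" for z w
    using const_mult_gca(1)[OF _ c z monom_below[OF w]] z w q by (auto simp: monom_poly)
  have add: "monom P (z \<oplus> w) 0 = monom P z 0 \<oplus>\<^bsub>?Q\<^esub> monom P w 0"
    if z: "z \<in> carrier B" and w: "w \<in> carrier B" for z w
    using z w monom_in_up[OF z, of 0] monom_in_up[OF w, of 0]
    by (auto simp: add_gca add_poly monom_poly)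
  have inj_const: "inj_on (\<lambda>z. monom P z 0) ?W"
  proof (rule inj_onI)
    fix z w assume "z \<in> ?W" "w \<in> ?W" and "monom P z 0 = monom P w 0"
    then show "z = w"
      using W(1)[of z] W(1)[of w] by (auto simp: monom_poly dest: fun_cong[of _ _ 0])
  qed
  have image: "(\<lambda>z. \<phi> (monom P z 0)) ` ?W = ring_center R"
    using center_of_gca_copy[OF q c Z stable ord \<phi>] by simp
  have "inj_on \<phi> ((\<lambda>z. monom P z 0) ` ?W)"
    using E(5) below W(1) by (auto simp: bij_betw_def intro: inj_on_subset)
  then have inj: "inj_on (\<lambda>z. \<phi> (monom P z 0)) ?W"
    using comp_inj_on[OF inj_const] by (simp add: comp_def)
  show ?thesis
  proof (rule ring_iso_memI, simp_all)
    show "\<phi> (monom P \<one> 0) = \<one>\<^bsub>R\<^esub>"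
      using E(4) by (simp add: one_gca)
    show "bij_betw (\<lambda>z. \<phi> (monom P z 0)) ?W (ring_center R)"
      using inj image by (simp add: bij_betw_def)
    fix z assume z: "z \<in> ring_center B \<and> z \<in> Fix B \<tau>"
    then show "\<phi> (monom P z 0) \<in> ring_center R"
      using image by auto
    fix w assume w: "w \<in> ring_center B \<and> w \<in> Fix B \<tau>"
    show "\<phi> (monom P (z \<otimes> w) 0) = \<phi> (monom P z 0) \<otimes>\<^bsub>R\<^esub> \<phi> (monom P w 0)"
      and "\<phi> (monom P (z \<oplus> w) 0) = \<phi> (monom P z 0) \<oplus>\<^bsub>R\<^esub> \<phi> (monom P w 0)"
      using z w W by (simp_all add: mult add E(2,3) below)
  qed
qed

lemma subring_central_fixed_points:
  assumes Z: "subring (ring_center B) B"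
  shows "subring (ring_center B \<inter> Fix B \<tau>) B"
proof (rule subringI)
  note ZE = subringE[OF Z] and H = ring_hom_memE[OF hom]
  interpret \<tau>: ring_hom_ring B B \<tau>
    using hom by (intro ring_hom_ringI2 ring_axioms)
  show "ring_center B \<inter> Fix B \<tau> \<subseteq> carrier B" "\<one> \<in> ring_center B \<inter> Fix B \<tau>"
    using ZE by (auto simp: Fix_def)
  fix x y assume x: "x \<in> ring_center B \<inter> Fix B \<tau>" and y: "y \<in> ring_center B \<inter> Fix B \<tau>"
  show "\<ominus> x \<in> ring_center B \<inter> Fix B \<tau>"
    using x ZE by (simp add: Fix_def)
  show "x \<otimes> y \<in> ring_center B \<inter> Fix B \<tau>" "x \<oplus> y \<in> ring_center B \<inter> Fix B \<tau>"
    using x y ZE by (simp_all add: Fix_def)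
qed

end

section \<open>Independence of characters\<close>

text \<open>
  The classical induction: a relation evaluated at \<open>y z\<close>, minus \<open>\<psi>(y)\<close> times the same relation at
  \<open>z\<close>, is a relation without \<open>\<psi>\<close>, in which \<open>a\<^sub>\<chi>\<close> has become \<open>a\<^sub>\<chi> (\<chi>(y) - \<psi>(y))\<close>.
  Characters are extensional so that distinct elements of \<open>C\<close> differ somewhere on \<open>G\<close>.
\<close>

lemma (in domain) dedekind_independence:
  fixes G :: "('g, 'n) monoid_scheme"
  assumes "monoid G" and "finite C"
    and "\<And>\<chi>. \<chi> \<in> C \<Longrightarrow> \<chi> \<in> hom G R \<inter> extensional (carrier G)"
    and "\<And>\<chi>. \<chi> \<in> C \<Longrightarrow> \<chi> \<one>\<^bsub>G\<^esub> = \<one>"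
    and "\<And>\<chi>. \<chi> \<in> C \<Longrightarrow> a \<chi> \<in> carrier R"
    and "\<And>z. z \<in> carrier G \<Longrightarrow> (\<Oplus>\<chi>\<in>C. a \<chi> \<otimes> \<chi> z) = \<zero>"
  shows "\<forall>\<chi>\<in>C. a \<chi> = \<zero>"
  using assms(2-)
proof (induction C arbitrary: a rule: finite_induct)
  case empty
  then show ?case by simp
next
  case (insert \<psi> C)
  interpret G: monoid G by fact
  note rel = insert.prems(4) and hyps = insert.hyps
  have hom: "\<chi> (y \<otimes>\<^bsub>G\<^esub> z) = \<chi> y \<otimes> \<chi> z" and closed: "\<chi> z \<in> carrier R"
    if "\<chi> \<in> insert \<psi> C" "y \<in> carrier G" "z \<in> carrier G" for \<chi> y z
    using insert.prems(1)[OF that(1)] that(2,3) by (auto simp: hom_def)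
  have coeff: "a \<chi> \<in> carrier R" if "\<chi> \<in> insert \<psi> C" for \<chi>
    using insert.prems(3) that .
  have shifted: "a \<chi> \<otimes> (\<chi> y \<ominus> \<psi> y) = \<zero>" if \<chi>: "\<chi> \<in> C" and y: "y \<in> carrier G" for \<chi> y
  proof -
    have "(\<Oplus>\<chi>\<in>C. a \<chi> \<otimes> (\<chi> y \<ominus> \<psi> y) \<otimes> \<chi> z) = \<zero>" if z: "z \<in> carrier G" for z
    proof -
      let ?yz = "\<Oplus>\<chi>\<in>C. a \<chi> \<otimes> \<chi> (y \<otimes>\<^bsub>G\<^esub> z)" and ?z = "\<Oplus>\<chi>\<in>C. a \<chi> \<otimes> \<chi> z"
      note cl = closed[OF _ y y] closed[OF _ z z] coeff
      have fz: "(\<lambda>\<chi>. a \<chi> \<otimes> \<chi> z) \<in> C \<rightarrow> carrier R"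
        using cl by auto
      have fyz: "(\<lambda>\<chi>. a \<chi> \<otimes> \<chi> (y \<otimes>\<^bsub>G\<^esub> z)) \<in> C \<rightarrow> carrier R"
        using closed[OF _ y G.m_closed[OF y z]] coeff by auto
      have c0: "?z \<in> carrier R" "?yz \<in> carrier R"
        using fz fyz by (auto intro: finsum_closed)
      have e1: "a \<psi> \<otimes> \<psi> z \<oplus> ?z = \<zero>"
        using rel[OF z] finsum_insert[OF hyps fz] cl by simp
      have e2: "a \<psi> \<otimes> (\<psi> y \<otimes> \<psi> z) \<oplus> ?yz = \<zero>"
        using rel[OF G.m_closed[OF y z]] finsum_insert[OF hyps fyz] cl hom[OF _ y z, of \<psi>] by simp
      have "(\<Oplus>\<chi>\<in>C. a \<chi> \<otimes> (\<chi> y \<ominus> \<psi> y) \<otimes> \<chi> z)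
          = (\<Oplus>\<chi>\<in>C. a \<chi> \<otimes> \<chi> (y \<otimes>\<^bsub>G\<^esub> z) \<oplus> (\<ominus> \<psi> y) \<otimes> (a \<chi> \<otimes> \<chi> z))"
      proof (rule finsum_cong')
        fix \<chi> assume "\<chi> \<in> C"
        then have "a \<chi> \<in> carrier R" "\<chi> y \<in> carrier R" "\<chi> z \<in> carrier R" "\<psi> y \<in> carrier R"
          and "\<chi> (y \<otimes>\<^bsub>G\<^esub> z) = \<chi> y \<otimes> \<chi> z"
          using cl hom[OF _ y z] by auto
        then show "a \<chi> \<otimes> (\<chi> y \<ominus> \<psi> y) \<otimes> \<chi> z
            = a \<chi> \<otimes> \<chi> (y \<otimes>\<^bsub>G\<^esub> z) \<oplus> (\<ominus> \<psi> y) \<otimes> (a \<chi> \<otimes> \<chi> z)"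
          by (simp add: a_minus_def r_distr l_distr r_minus l_minus m_ac)
      qed (use fz fyz cl in auto)
      also have "\<dots> = ?yz \<oplus> (\<ominus> \<psi> y) \<otimes> ?z"
        using fz fyz cl hyps(1) by (simp add: finsum_addf finsum_rdistr Pi_def)
      also have "\<dots> = \<zero>"
      proof -
        have t: "a \<psi> \<otimes> \<psi> z \<in> carrier R" "\<psi> y \<otimes> (a \<psi> \<otimes> \<psi> z) \<in> carrier R"
          using cl by simp_all
        have "a \<psi> \<otimes> (\<psi> y \<otimes> \<psi> z) = \<psi> y \<otimes> (a \<psi> \<otimes> \<psi> z)"
          using cl by (simp add: m_lcomm)
        then have "?yz \<oplus> \<psi> y \<otimes> (a \<psi> \<otimes> \<psi> z) = \<zero>"
          using e2 a_comm[OF c0(2) t(2)] by simp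
        from minus_equality[OF this t(2) c0(2)] have "?yz = \<ominus> (\<psi> y \<otimes> (a \<psi> \<otimes> \<psi> z))"
          by (rule sym)
        moreover have "?z \<oplus> a \<psi> \<otimes> \<psi> z = \<zero>"
          using e1 a_comm[OF c0(1) t(1)] by simp
        from minus_equality[OF this t(1) c0(1)] have "?z = \<ominus> (a \<psi> \<otimes> \<psi> z)"
          by (rule sym)
        ultimately show ?thesis
          using cl by (simp add: l_minus r_minus l_neg)
      qed
      finally show ?thesis .
    qed
    then show ?thesis
      using insert.IH[of "\<lambda>\<chi>. a \<chi> \<otimes> (\<chi> y \<ominus> \<psi> y)"] insert.prems(1,2) closed[OF _ y y] coeff \<chi>
      by simp
  qed
  have zero: "a \<chi> = \<zero>" if \<chi>: "\<chi> \<in> C" for \<chi>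
  proof -
    have "\<chi> \<noteq> \<psi>"
      using \<chi> hyps(2) by auto
    then obtain y where y: "y \<in> carrier G" "\<chi> y \<noteq> \<psi> y"
      using insert.prems(1)[of \<chi>] insert.prems(1)[of \<psi>] \<chi> by (auto intro: extensionalityI)
    then show ?thesis
      using shifted[OF \<chi> y(1)] \<chi> coeff[of \<chi>] closed[of _ y y] by (auto simp: integral_iff)
  qed
  moreover have cl1: "\<chi> \<one>\<^bsub>G\<^esub> \<in> carrier R" if "\<chi> \<in> insert \<psi> C" for \<chi>
    using closed[OF that G.one_closed G.one_closed] .
  ultimately have "(\<Oplus>\<chi>\<in>C. a \<chi> \<otimes> \<chi> \<one>\<^bsub>G\<^esub>) = (\<Oplus>\<chi>\<in>C. \<zero>)"
    by (intro finsum_cong') auto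
  then have "(\<Oplus>\<chi>\<in>insert \<psi> C. a \<chi> \<otimes> \<chi> \<one>\<^bsub>G\<^esub>) = a \<psi>"
    using finsum_insert[OF hyps, of "\<lambda>\<chi>. a \<chi> \<otimes> \<chi> \<one>\<^bsub>G\<^esub>"] coeff cl1 insert.prems(2)[of \<psi>]
    by (simp add: Pi_def)
  then have "a \<psi> = \<zero>"
    using rel[OF G.one_closed] by simp
  then show ?case
    using zero by simp
qed

corollary (in domain) equal_character_sums_meet:
  fixes G :: "('g, 'n) monoid_scheme"
  assumes G: "monoid G" and fin: "finite C" "finite D" and ne: "C \<noteq> {}"
    and char: "\<And>\<chi>. \<chi> \<in> C \<union> D \<Longrightarrow> \<chi> \<in> hom G R \<inter> extensional (carrier G)"
    and one: "\<And>\<chi>. \<chi> \<in> C \<union> D \<Longrightarrow> \<chi> \<one>\<^bsub>G\<^esub> = \<one>"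
    and sums: "\<And>z. z \<in> carrier G \<Longrightarrow> (\<Oplus>\<chi>\<in>C. \<chi> z) = (\<Oplus>\<chi>\<in>D. \<chi> z)"
  shows "C \<inter> D \<noteq> {}"
proof
  assume disj: "C \<inter> D = {}"
  \<comment> \<open>The difference of the two sums is a relation with coefficients \<open>1\<close> and \<open>-1\<close>.\<close>
  define a where "a \<chi> = (if \<chi> \<in> C then \<one> else \<ominus> \<one>)" for \<chi> :: "'g \<Rightarrow> 'a"
  have closed: "\<chi> z \<in> carrier R" if "\<chi> \<in> C \<union> D" "z \<in> carrier G" for \<chi> z
    using char[OF that(1)] that(2) by (auto simp: hom_def)
  have "(\<Oplus>\<chi>\<in>C \<union> D. a \<chi> \<otimes> \<chi> z) = \<zero>" if z: "z \<in> carrier G" for z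
  proof -
    have cl: "(\<lambda>\<chi>. \<chi> z) \<in> C \<rightarrow> carrier R" "(\<lambda>\<chi>. \<chi> z) \<in> D \<rightarrow> carrier R"
      using closed[OF _ z] by auto
    have "(\<Oplus>\<chi>\<in>C \<union> D. a \<chi> \<otimes> \<chi> z) = (\<Oplus>\<chi>\<in>C. a \<chi> \<otimes> \<chi> z) \<oplus> (\<Oplus>\<chi>\<in>D. a \<chi> \<otimes> \<chi> z)"
      using fin disj closed[OF _ z] by (intro finsum_Un_disjoint) (auto simp: a_def)
    also have "(\<Oplus>\<chi>\<in>C. a \<chi> \<otimes> \<chi> z) = (\<Oplus>\<chi>\<in>C. \<chi> z)"
      using closed[OF _ z] by (intro finsum_cong') (auto simp: a_def)
    also have "(\<Oplus>\<chi>\<in>D. a \<chi> \<otimes> \<chi> z) = (\<Oplus>\<chi>\<in>D. (\<ominus> \<one>) \<otimes> \<chi> z)"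
      using closed[OF _ z] disj by (intro finsum_cong') (auto simp: a_def)
    also have "\<dots> = (\<ominus> \<one>) \<otimes> (\<Oplus>\<chi>\<in>D. \<chi> z)"
      using fin(2) cl(2) by (simp add: finsum_rdistr)
    also have "(\<Oplus>\<chi>\<in>C. \<chi> z) \<oplus> \<dots> = \<zero>"
      using sums[OF z] finsum_closed[OF cl(2)] by (simp add: l_minus r_neg)
    finally show ?thesis .
  qed
  moreover have "a \<chi> \<in> carrier R" for \<chi>
    by (simp add: a_def)
  ultimately have "\<forall>\<chi>\<in>C \<union> D. a \<chi> = \<zero>"
    using fin char one by (intro dedekind_independence[OF G]) simp_all
  moreover obtain \<chi> where "\<chi> \<in> C"
    using ne by blast
  ultimately have "a \<chi> = \<zero>"
    by blast
  then show False
    using \<open>\<chi> \<in> C\<close> by (simp add: a_def)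
qed

section \<open>Homomorphisms over the fixed points of a finite-order automorphism\<close>

lemma (in ring) trace_invariant:
  assumes \<sigma>: "\<sigma> \<in> ring_hom R R" and q: "0 < q" and z: "z \<in> carrier R" and period: "(\<sigma> ^^ q) z = z"
  shows "\<sigma> (\<Oplus>j\<in>{..<q}. (\<sigma> ^^ j) z) = (\<Oplus>j\<in>{..<q}. (\<sigma> ^^ j) z)"
proof -
  obtain m where m: "q = Suc m"
    using q by (cases q) auto
  have pow: "(\<sigma> ^^ j) z \<in> carrier R" for j
    using ring_hom_memE(1)[OF ring_hom_funpow[OF \<sigma>] z] .
  \<comment> \<open>Split off the last summand of \<open>{..Suc m}\<close> and then the first: both are \<open>z\<close>.\<close>
  let ?f = "\<lambda>j. (\<sigma> ^^ j) z"
  interpret \<sigma>: ring_hom_ring R R \<sigma>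
    using \<sigma> by (intro ring_hom_ringI2 ring_axioms)
  have cl: "(\<Oplus>j\<in>{..m}. ?f j) \<in> carrier R" "(\<Oplus>j\<in>{..m}. ?f (Suc j)) \<in> carrier R"
    using pow by (intro finsum_closed; simp del: funpow.simps)+
  have "(\<Oplus>j\<in>{..m}. ?f (Suc j)) \<oplus> z = (\<Oplus>j\<in>{..Suc m}. ?f j)"
    using pow finsum_Suc2[of ?f m] by (simp del: funpow.simps add: funpow_0)
  also have "\<dots> = z \<oplus> (\<Oplus>j\<in>{..m}. ?f j)"
    using pow finsum_Suc[of ?f m] period by (simp del: funpow.simps add: m)
  finally have "(\<Oplus>j\<in>{..m}. ?f (Suc j)) = (\<Oplus>j\<in>{..m}. ?f j)"
    using cl z by (metis a_comm add.right_cancel)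
  then show ?thesis
    using pow by (simp add: m lessThan_Suc_atMost comp_def)
qed

text \<open>
  The maps \<open>f \<circ> \<sigma>\<^sup>j\<close> for \<open>j < q\<close> are distinct characters of \<open>Z\<close> with values in \<open>K\<close>, and
  their sum at \<open>z\<close> is \<open>f\<close> of the trace of \<open>z\<close>. The same holds for \<open>g\<close>. Traces are fixed by
  \<^term>\<open>\<sigma>\<close>, so both families have the same sum, and independence of characters forces a common
  member \<open>f \<circ> \<sigma>\<^sup>i = g \<circ> \<sigma>\<^sup>j\<close>. Composing with \<open>\<sigma>\<^sup>q\<^sup>-\<^sup>i\<close> gives the claim.
\<close>

lemma homs_agreeing_on_fixed_points_differ_by_power:
  fixes Z :: "('z, 'm) ring_scheme" and K :: "('k, 'l) ring_scheme"
  assumes Z: "field Z" and K: "field K"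
    and \<sigma>: "\<sigma> \<in> ring_hom Z Z" and ord: "has_order_on (carrier Z) \<sigma> q"
    and f: "f \<in> ring_hom Z K" and g: "g \<in> ring_hom Z K"
    and agree: "\<And>z. z \<in> Fix Z \<sigma> \<Longrightarrow> f z = g z"
  shows "\<exists>m. \<forall>z\<in>carrier Z. f z = g ((\<sigma> ^^ m) z)"
proof -
  interpret Z: field Z by fact
  interpret K: field K by fact
  have q: "0 < q" and period: "\<And>z. z \<in> carrier Z \<Longrightarrow> (\<sigma> ^^ q) z = z"
    and least: "\<And>d. 0 < d \<Longrightarrow> d < q \<Longrightarrow> \<exists>z\<in>carrier Z. (\<sigma> ^^ d) z \<noteq> z"
    using ord by (auto simp: has_order_on_def)
  note pow_hom = ring_hom_funpow[OF \<sigma>]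
  have pow [simp]: "(\<sigma> ^^ j) z \<in> carrier Z" if "z \<in> carrier Z" for j z
    using ring_hom_memE(1)[OF pow_hom that] .
  define X where "X h j = restrict (\<lambda>z. h ((\<sigma> ^^ j) z)) (carrier Z)" for h :: "'z \<Rightarrow> 'k" and j
  have inj: "inj_on (X h) {..<q}" if h: "h \<in> ring_hom Z K" for h
  proof (rule linorder_inj_onI')
    fix i j assume ij: "i \<in> {..<q}" "j \<in> {..<q}" "i < j"
    then have "0 < j - i" "j - i < q"
      by auto
    then obtain z where z: "z \<in> carrier Z" "(\<sigma> ^^ (j - i)) z \<noteq> z"
      using least by blast
    have inj_h: "inj_on (\<lambda>z. h ((\<sigma> ^^ i) z)) (carrier Z)"
      using non_trivial_field_hom_is_inj[OF ring_hom_trans[OF pow_hom h] Z K] by (simp add: comp_def)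
    have "(\<sigma> ^^ j) z = (\<sigma> ^^ i) ((\<sigma> ^^ (j - i)) z)"
      using ij(3) by (simp flip: funpow_add[THEN fun_cong, unfolded comp_def])
    then have "X h i z \<noteq> X h j z"
      using inj_onD[OF inj_h, of z "(\<sigma> ^^ (j - i)) z"] z by (auto simp: X_def)
    then show "X h i \<noteq> X h j"
      by auto
  qed
  have X_sum: "(\<Oplus>\<^bsub>K\<^esub>\<chi>\<in>X h ` {..<q}. \<chi> z) = h (\<Oplus>\<^bsub>Z\<^esub>j\<in>{..<q}. (\<sigma> ^^ j) z)"
    if h: "h \<in> ring_hom Z K" and z: "z \<in> carrier Z" for h z
  proof -
    interpret h: ring_hom_ring Z K h
      using h by (intro ring_hom_ringI2 Z.ring_axioms K.ring_axioms)
    have "(\<Oplus>\<^bsub>K\<^esub>\<chi>\<in>X h ` {..<q}. \<chi> z) = (\<Oplus>\<^bsub>K\<^esub>j\<in>{..<q}. X h j z)"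
      using inj[OF h] z by (intro K.finsum_reindex) (auto simp: X_def)
    also have "\<dots> = h (\<Oplus>\<^bsub>Z\<^esub>j\<in>{..<q}. (\<sigma> ^^ j) z)"
      using z by (simp add: X_def comp_def)
    finally show ?thesis .
  qed
  have "X f ` {..<q} \<inter> X g ` {..<q} \<noteq> {}"
  proof (rule K.equal_character_sums_meet[where G = Z])
    fix \<chi> assume "\<chi> \<in> X f ` {..<q} \<union> X g ` {..<q}"
    then obtain h j where h: "h \<in> ring_hom Z K" and \<chi>: "\<chi> = X h j"
      using f g by auto
    note E = ring_hom_memE[OF ring_hom_trans[OF pow_hom h], unfolded comp_def]
    show "\<chi> \<in> hom Z K \<inter> extensional (carrier Z)"
      using E(1,2) by (auto simp: hom_def \<chi> X_def)
    show "\<chi> \<one>\<^bsub>Z\<^esub> = \<one>\<^bsub>K\<^esub>"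
      using E(4) by (simp add: \<chi> X_def)
  next
    fix z assume z: "z \<in> carrier Z"
    have "(\<Oplus>\<^bsub>Z\<^esub>j\<in>{..<q}. (\<sigma> ^^ j) z) \<in> Fix Z \<sigma>"
      using Z.trace_invariant[OF \<sigma> q z period[OF z]] z by (simp add: Fix_def)
    then show "(\<Oplus>\<^bsub>K\<^esub>\<chi>\<in>X f ` {..<q}. \<chi> z) = (\<Oplus>\<^bsub>K\<^esub>\<chi>\<in>X g ` {..<q}. \<chi> z)"
      using agree z by (simp add: X_sum f g)
  qed (use q Z.monoid_axioms in auto)
  then obtain i j where i: "i < q" and eq: "X f i = X g j"
    by auto
  have "f z = g ((\<sigma> ^^ (j + (q - i))) z)" if z: "z \<in> carrier Z" for z
  proof -
    have "z = (\<sigma> ^^ i) ((\<sigma> ^^ (q - i)) z)"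
      using i period[OF z] by (simp flip: funpow_add[THEN fun_cong, unfolded comp_def])
    then have "f z = X f i ((\<sigma> ^^ (q - i)) z)"
      using z by (simp add: X_def)
    also have "\<dots> = g ((\<sigma> ^^ (j + (q - i))) z)"
      using z unfolding eq by (simp add: X_def funpow_add)
    finally show ?thesis .
  qed
  then show ?thesis by blast
qed

section \<open>Solvable Galois groups\<close>

lemma (in group) solvable_of_solvable_subgroup:
  assumes H: "subgroup H G" and der: "derived G (carrier G) \<subseteq> H"
    and sol: "solvable (G\<lparr>carrier := H\<rparr>)"
  shows "solvable G"
proof -
  interpret incl: group_hom "G\<lparr>carrier := H\<rparr>" G "\<lambda>x. x"
    using subgroup.subset[OF H]
    by (intro group_hom.intro subgroup_imp_group[OF H] group_axioms group_hom_axioms.intro)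
      (auto simp: hom_def)
  have "solvable_seq G ((\<lambda>x. x) ` H)"
    using incl.solvable_imp_solvable_img[of H] sol by (simp add: solvable_def)
  then obtain n where n: "(derived G ^^ n) H = {\<one>}"
    using solvable_imp_trivial_derived_seq by auto
  have "(derived G ^^ Suc n) (carrier G) \<subseteq> (derived G ^^ n) H"
    using mono_exp_of_derived[OF der] by (simp add: funpow_swap1)
  moreover have "\<one> \<in> (derived G ^^ Suc n) (carrier G)"
    using subgroup.one_closed[OF exp_of_derived_is_subgroup[OF subgroup_self]] .
  ultimately show ?thesis
    using n solvable_iff_trivial_derived_seq by blast
qed

lemma carrier_Gal_iff:
  "\<sigma> \<in> carrier (Gal R M X) \<longleftrightarrow>
     \<sigma> \<in> Bij M \<and> \<sigma> \<in> ring_iso (R\<lparr>carrier := M\<rparr>) (R\<lparr>carrier := M\<rparr>) \<and> (\<forall>x\<in>X. \<sigma> x = x)"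
  by (simp add: Gal_def)

lemma subgroup_Gal:
  assumes R: "ring (R\<lparr>carrier := M\<rparr>)" and XM: "X \<subseteq> M"
  shows "subgroup (carrier (Gal R M X)) (BijGroup M)"
proof -
  let ?M = "R\<lparr>carrier := M\<rparr>"
  interpret M: ring ?M by fact
  interpret Bij: group "BijGroup M" by (rule group_BijGroup)
  show ?thesis
  proof (rule Bij.subgroupI)
    show "carrier (Gal R M X) \<subseteq> carrier (BijGroup M)"
      by (auto simp: carrier_Gal_iff BijGroup_def)
    have "(\<lambda>x\<in>M. x) \<in> ring_iso ?M ?M"
      using M.m_closed M.a_closed M.one_closed
      by (intro ring_iso_memI) (auto simp: bij_betw_def inj_on_def)
    then show "carrier (Gal R M X) \<noteq> {}"
      using id_Bij[of M] XM by (fastforce simp: carrier_Gal_iff)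
  next
    fix \<sigma> assume s: "\<sigma> \<in> carrier (Gal R M X)"
    then have B: "\<sigma> \<in> Bij M" and iso: "\<sigma> \<in> ring_iso ?M ?M" and fx: "\<forall>x\<in>X. \<sigma> x = x"
      by (auto simp: carrier_Gal_iff)
    have inj: "inj_on \<sigma> M"
      using B by (auto simp: Bij_def bij_betw_def)
    have "inv_into M \<sigma> \<in> ring_iso ?M ?M"
      using ring_iso_set_sym[OF R iso] by simp
    then have "(\<lambda>x\<in>M. inv_into M \<sigma> x) \<in> ring_iso ?M ?M"
      by (rule M.ring_iso_restrict) simp
    moreover have "(\<lambda>x\<in>M. inv_into M \<sigma> x) x = x" if "x \<in> X" for x
      using that XM fx inv_into_f_f[OF inj, of x] by auto
    ultimately show "inv\<^bsub>BijGroup M\<^esub> \<sigma> \<in> carrier (Gal R M X)"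
      using B restrict_inv_into_Bij[OF B] by (simp add: inv_BijGroup carrier_Gal_iff)
    fix \<rho> assume r: "\<rho> \<in> carrier (Gal R M X)"
    then have B': "\<rho> \<in> Bij M" and iso': "\<rho> \<in> ring_iso ?M ?M" and fx': "\<forall>x\<in>X. \<rho> x = x"
      by (auto simp: carrier_Gal_iff)
    have "compose M \<sigma> \<rho> \<in> ring_iso ?M ?M"
      using ring_iso_set_trans[OF iso' iso] by (rule M.ring_iso_restrict) (simp add: compose_def)
    moreover have "compose M \<sigma> \<rho> x = x" if "x \<in> X" for x
      using that XM fx fx' by (auto simp: compose_def)
    ultimately show "\<sigma> \<otimes>\<^bsub>BijGroup M\<^esub> \<rho> \<in> carrier (Gal R M X)"
      using B B' by (simp add: BijGroup_def carrier_Gal_iff compose_Bij)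
  qed
qed

lemma Gal_eq: "Gal R M X = BijGroup M\<lparr>carrier := carrier (Gal R M X)\<rparr>"
  by (simp add: Gal_def)

text \<open>
  The hypothesis on \<open>X\<close> makes the commutators of the group over \<open>Y\<close> fix \<open>X\<close> pointwise. It is
  applied to the inverses of \<open>g\<close> and \<open>h\<close>: in the commutator these act first, on an element that is
  known to lie in \<open>X\<close>.
\<close>

lemma solvable_Gal_if_commuting_on:
  assumes R: "ring (R\<lparr>carrier := M\<rparr>)" and XM: "X \<subseteq> M" and YX: "Y \<subseteq> X"
    and sol: "solvable (Gal R M X)"
    and comm: "\<And>g h x. g \<in> carrier (Gal R M Y) \<Longrightarrow> h \<in> carrier (Gal R M Y) \<Longrightarrow> x \<in> X \<Longrightarrow>
                 g (h x) = h (g x)"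
  shows "solvable (Gal R M Y)"
proof -
  interpret Bij: group "BijGroup M" by (rule group_BijGroup)
  have YM: "Y \<subseteq> M" using YX XM by blast
  note sY = subgroup_Gal[OF R YM] and sX = subgroup_Gal[OF R XM]
  interpret G: group "Gal R M Y"
    using Bij.subgroup_imp_group[OF sY] by (subst Gal_eq)
  have sub: "carrier (Gal R M X) \<subseteq> carrier (Gal R M Y)"
    using subsetD[OF YX] by (auto simp: carrier_Gal_iff)
  have sXY: "subgroup (carrier (Gal R M X)) (Gal R M Y)"
    using Bij.subgroup_incl[OF sX sY sub] by (subst Gal_eq)
  have "g \<otimes>\<^bsub>Gal R M Y\<^esub> h \<otimes>\<^bsub>Gal R M Y\<^esub> inv\<^bsub>Gal R M Y\<^esub> g \<otimes>\<^bsub>Gal R M Y\<^esub> inv\<^bsub>Gal R M Y\<^esub> h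
          \<in> carrier (Gal R M X)" (is "?c \<in> _")
    if g: "g \<in> carrier (Gal R M Y)" and h: "h \<in> carrier (Gal R M Y)" for g h
  proof -
    let ?g = "inv\<^bsub>Gal R M Y\<^esub> g" and ?h = "inv\<^bsub>Gal R M Y\<^esub> h"
    have g': "?g \<in> carrier (Gal R M Y)" and h': "?h \<in> carrier (Gal R M Y)"
      using g h by auto
    have c: "?c \<in> carrier (Gal R M Y)"
      using g h by auto
    have mult: "(u \<otimes>\<^bsub>Gal R M Y\<^esub> v) x = u (v x)"
      if "u \<in> carrier (Gal R M Y)" "v \<in> carrier (Gal R M Y)" "x \<in> M" for u v x
      using that by (subst Gal_eq) (simp add: BijGroup_def carrier_Gal_iff compose_def)
    have one: "\<one>\<^bsub>Gal R M Y\<^esub> x = x" if "x \<in> M" for x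
      using that by (subst Gal_eq) (simp add: BijGroup_def)
    have cl: "u x \<in> M" if "u \<in> carrier (Gal R M Y)" "x \<in> M" for u x
      using that Bij_imp_funcset[of u M] by (auto simp: carrier_Gal_iff)
    have cancel: "u ((inv\<^bsub>Gal R M Y\<^esub> u) x) = x" if "u \<in> carrier (Gal R M Y)" "x \<in> M" for u x
      using mult[OF that(1) G.inv_closed[OF that(1)] that(2)] one[OF that(2)] that(1) by simp
    have "?c x = x" if x: "x \<in> X" for x
    proof -
      have xM: "x \<in> M" using x XM by blast
      \<comment> \<open>The inverses commute on \<open>x\<close>, and then everything cancels from the inside.\<close>
      have "?c x = g (h (?g (?h x)))"
        using g h g' h' xM cl by (simp add: mult)
      also have "\<dots> = g (h (?h (?g x)))"
        using comm[OF g' h' x] by simp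
      also have "\<dots> = x"
        using cancel[OF h cl[OF g' xM]] cancel[OF g xM] by simp
      finally show ?thesis .
    qed
    then show ?thesis
      using c by (simp add: carrier_Gal_iff)
  qed
  then have "derived (Gal R M Y) (carrier (Gal R M Y)) \<subseteq> carrier (Gal R M X)"
    unfolding derived_def by (intro G.generate_subgroup_incl sXY) blast
  moreover have "Gal R M Y\<lparr>carrier := carrier (Gal R M X)\<rparr> = Gal R M X"
    by (simp add: Gal_def)
  ultimately show ?thesis
    using G.solvable_of_solvable_subgroup[OF sXY] sol by simp
qed

lemma solvable_Gal_over_fixed_points:
  assumes Z: "field Z" and K: "field (R\<lparr>carrier := M\<rparr>)"
    and \<sigma>: "\<sigma> \<in> ring_hom Z Z" and ord: "has_order_on (carrier Z) \<sigma> q"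
    and \<theta>: "\<theta> \<in> ring_hom Z (R\<lparr>carrier := M\<rparr>)"
    and sol: "solvable (Gal R M (\<theta> ` carrier Z))"
  shows "solvable (Gal R M (\<theta> ` Fix Z \<sigma>))"
proof (rule solvable_Gal_if_commuting_on[OF _ _ _ sol])
  interpret Z: field Z by fact
  show "ring (R\<lparr>carrier := M\<rparr>)"
    using K by (simp add: field_def domain_def cring_def)
  show "\<theta> ` carrier Z \<subseteq> M"
    using ring_hom_memE(1)[OF \<theta>] by auto
  show "\<theta> ` Fix Z \<sigma> \<subseteq> \<theta> ` carrier Z"
    by (auto simp: Fix_def)
  note pow = ring_hom_memE(1)[OF ring_hom_funpow[OF \<sigma>]]
  have power: "\<exists>m. \<forall>z\<in>carrier Z. g (\<theta> z) = \<theta> ((\<sigma> ^^ m) z)"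
    if g: "g \<in> carrier (Gal R M (\<theta> ` Fix Z \<sigma>))" for g
  proof -
    have "g \<in> ring_hom (R\<lparr>carrier := M\<rparr>) (R\<lparr>carrier := M\<rparr>)" and "\<And>z. z \<in> Fix Z \<sigma> \<Longrightarrow> g (\<theta> z) = \<theta> z"
      using g by (auto simp: carrier_Gal_iff ring_iso_def)
    then show ?thesis
      using homs_agreeing_on_fixed_points_differ_by_power[OF Z K \<sigma> ord ring_hom_trans[OF \<theta>] \<theta>] by simp
  qed
  fix g h x
  assume "g \<in> carrier (Gal R M (\<theta> ` Fix Z \<sigma>))" "h \<in> carrier (Gal R M (\<theta> ` Fix Z \<sigma>))"
    and x: "x \<in> \<theta> ` carrier Z"
  then obtain i j where i: "\<And>z. z \<in> carrier Z \<Longrightarrow> g (\<theta> z) = \<theta> ((\<sigma> ^^ i) z)"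
    and j: "\<And>z. z \<in> carrier Z \<Longrightarrow> h (\<theta> z) = \<theta> ((\<sigma> ^^ j) z)"
    using power by meson
  obtain z where z: "z \<in> carrier Z" and xz: "x = \<theta> z"
    using x by blast
  have "(\<sigma> ^^ i) ((\<sigma> ^^ j) z) = (\<sigma> ^^ j) ((\<sigma> ^^ i) z)"
    by (metis add.commute comp_apply funpow_add)
  then show "g (h x) = h (g x)"
    using z by (simp add: xz i j pow)
qed

section \<open>One step of the chain\<close>

text \<open>
  Constants followed by the given isomorphism identify the \<^term>\<open>\<tau>\<close>-fixed central elements of \<open>T\<close>
  with the center of \<open>U\<close>. Inverting this identification and applying \<^term>\<open>\<theta>\<close> gives the embedding
  of the center of \<open>U\<close>.
\<close>

lemma center_embedding_step:
  fixes A :: "('a, 'm) ring_scheme"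
  assumes A: "ring A" and M: "subfield M A" and B: "subring T A"
    and q: "1 < q" and F: "F \<subseteq> ring_center (A\<lparr>carrier := T\<rparr>)" and fixF: "\<And>x. x \<in> F \<Longrightarrow> \<tau> x = x"
    and data: "generalised_cyclic_data (A\<lparr>carrier := T\<rparr>) \<tau> q c"
    and iso: "gca_isomorphic_over F (A\<lparr>carrier := T\<rparr>) \<tau> q c (A\<lparr>carrier := U\<rparr>)"
    and \<theta>: "\<theta> \<in> ring_hom (A\<lparr>carrier := ring_center (A\<lparr>carrier := T\<rparr>)\<rparr>) (A\<lparr>carrier := M\<rparr>)"
    and \<theta>F: "\<And>x. x \<in> F \<Longrightarrow> \<theta> x = x"
    and sol: "solvable (Gal A M (\<theta> ` ring_center (A\<lparr>carrier := T\<rparr>)))"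
  obtains \<eta> where "\<eta> \<in> ring_hom (A\<lparr>carrier := ring_center (A\<lparr>carrier := U\<rparr>)\<rparr>) (A\<lparr>carrier := M\<rparr>)"
    and "\<And>x. x \<in> F \<Longrightarrow> \<eta> x = x"
    and "solvable (Gal A M (\<eta> ` ring_center (A\<lparr>carrier := U\<rparr>)))"
proof -
  let ?B = "A\<lparr>carrier := T\<rparr>" and ?K = "A\<lparr>carrier := M\<rparr>"
  let ?Z = "ring_center ?B"
  let ?W = "?Z \<inter> Fix ?B \<tau>"
  have csa: "subfield ?Z ?B" and \<tau>: "\<tau> \<in> ring_iso ?B ?B"
    and ord: "has_order_on ?Z \<tau> q" and "c \<in> Units (?B\<lparr>carrier := Fix ?B \<tau>\<rparr>)"
    using data by (auto simp: generalised_cyclic_data_def central_simple_algebra_def)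
  then have c: "c \<in> carrier ?B"
    by (simp add: Units_def Fix_def)
  have "ring ?B"
    using ring.subring_is_ring[OF A B] .
  then interpret B: skew_polynomials ?B \<tau>
    using \<tau> by (simp add: skew_polynomials_def skew_polynomials_axioms_def ring_iso_def)
  note E = ring_iso_memE[OF \<tau>]
  have stable: "\<tau> ` ?Z \<subseteq> ?Z"
    using ring_iso_image_center[OF \<tau>] .
  have ZT: "?Z \<subseteq> T"
    by (auto simp: ring_center_def)
  have Z: "field (A\<lparr>carrier := ?Z\<rparr>)"
    using B.subfield_iff(2)[OF csa] by simp
  have K: "field ?K"
    using ring.subfield_iff(2)[OF A M] .
  have \<tau>Z: "\<tau> \<in> ring_hom (A\<lparr>carrier := ?Z\<rparr>) (A\<lparr>carrier := ?Z\<rparr>)"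
    using E ZT stable by (intro ring_hom_memI) (auto simp: subset_iff)
  have FixZ: "Fix (A\<lparr>carrier := ?Z\<rparr>) \<tau> = ?W"
    using ZT by (auto simp: Fix_def)
  obtain \<phi> where \<phi>: "\<phi> \<in> ring_iso (generalised_cyclic_algebra ?B \<tau> q c) (A\<lparr>carrier := U\<rparr>)"
    and \<phi>F: "\<And>a. a \<in> F \<Longrightarrow> \<phi> (monom (twisted_poly ?B \<tau>) a 0) = a"
    using iso unfolding gca_isomorphic_over_def by blast
  define \<kappa> where "\<kappa> z = \<phi> (monom (twisted_poly ?B \<tau>) z 0)" for z
  let ?Y = "ring_center (A\<lparr>carrier := U\<rparr>)"
  have \<kappa>: "\<kappa> \<in> ring_iso (A\<lparr>carrier := ?W\<rparr>) (A\<lparr>carrier := ?Y\<rparr>)"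
    using B.central_fixed_points_iso_center[OF q c csa stable ord \<phi>] by (simp add: \<kappa>_def[abs_def])
  then have bij: "bij_betw \<kappa> ?W ?Y"
    using ring_iso_memE(5) by fastforce
  have "ring (A\<lparr>carrier := ?W\<rparr>)"
    using B.subring_is_ring[OF B.subring_central_fixed_points[OF subfieldE(1)[OF csa]]] by simp
  from ring_iso_set_sym[OF this \<kappa>]
  have inv: "inv_into ?W \<kappa> \<in> ring_hom (A\<lparr>carrier := ?Y\<rparr>) (A\<lparr>carrier := ?W\<rparr>)"
    by (simp add: ring_iso_def)
  have \<theta>W: "\<theta> \<in> ring_hom (A\<lparr>carrier := ?W\<rparr>) ?K"
    using ring_hom_memE[OF \<theta>] by (intro ring_hom_memI) auto
  show ?thesis
  proof
    show "\<theta> \<circ> inv_into ?W \<kappa> \<in> ring_hom (A\<lparr>carrier := ?Y\<rparr>) ?K"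
      using ring_hom_trans[OF inv \<theta>W] .
    fix x assume x: "x \<in> F"
    then have "x \<in> ?W" "\<kappa> x = x"
      using F ZT fixF \<phi>F by (auto simp: Fix_def \<kappa>_def)
    then have "inv_into ?W \<kappa> x = x"
      using inv_into_f_f[of \<kappa> ?W x] bij by (simp add: bij_betw_def)
    then show "(\<theta> \<circ> inv_into ?W \<kappa>) x = x"
      using \<theta>F x by simp
  next
    have "(\<theta> \<circ> inv_into ?W \<kappa>) ` ?Y = \<theta> ` ?W"
      using bij_betw_inv_into[OF bij] unfolding image_comp[symmetric] by (simp add: bij_betw_def)
    then show "solvable (Gal A M ((\<theta> \<circ> inv_into ?W \<kappa>) ` ?Y))"
      using solvable_Gal_over_fixed_points[OF Z K \<tau>Z _ \<theta>, of q] ord sol FixZ by simp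
  qed
qed

theorem corollary8p13:
  fixes A :: "('a, 'm) ring_scheme"
    and F M :: "'a set" and n k :: nat
    and S :: "nat \<Rightarrow> 'a set"
    and \<tau> :: "nat \<Rightarrow> 'a \<Rightarrow> 'a"
    and q :: "nat \<Rightarrow> nat"
    and c :: "nat \<Rightarrow> 'a"
  assumes "crossed_product_algebra A M F n"
    and "maximal_subfield M A"
    and "carrier (Gal A M F) \<noteq> {\<one>\<^bsub>Gal A M F\<^esub>}"
    and "S 0 = M" and "S k = carrier A"
    and "\<And>i. i < k \<Longrightarrow> S i \<subseteq> S (Suc i)"
    and "\<And>i. i \<le> k \<Longrightarrow> subring (S i) A"
    and "\<And>i. i \<le> k \<Longrightarrow> maximal_subfield M (A\<lparr>carrier := S i\<rparr>)"
    and "\<And>i. i < k \<Longrightarrow> prime (q i)"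
    and "\<And>i. i < k \<Longrightarrow> \<tau> i \<in> ring_iso (A\<lparr>carrier := S i\<rparr>) (A\<lparr>carrier := S i\<rparr>)"
    and "\<And>i x. i < k \<Longrightarrow> x \<in> F \<Longrightarrow> \<tau> i x = x"
    and "\<And>i. i < k \<Longrightarrow> has_inner_order (A\<lparr>carrier := S i\<rparr>) (\<tau> i) (q i)"
    and "\<And>i. i < k \<Longrightarrow> restrict (\<tau> i) M \<in> carrier (Gal A M F)"
    and "\<And>i. i < k \<Longrightarrow> c i \<in> Units (A\<lparr>carrier := Fix (A\<lparr>carrier := S i\<rparr>) (\<tau> i)\<rparr>)"
    and "\<And>i. i < k \<Longrightarrow> generalised_cyclic_data (A\<lparr>carrier := S i\<rparr>) (\<tau> i) (q i) (c i)"
    and "\<And>i. i < k \<Longrightarrow>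
           gca_isomorphic_over F (A\<lparr>carrier := S i\<rparr>) (\<tau> i) (q i) (c i) (A\<lparr>carrier := S (Suc i)\<rparr>)"
  shows "solvable (Gal A M F)"
proof -
  have csa: "central_simple_algebra A F" and M: "subfield M A" and FM: "F \<subseteq> M"
    using assms(1) by (auto simp: crossed_product_algebra_def has_degree_def galois_extension_def)
  then have A: "ring A" and center: "ring_center A = F"
    by (auto simp: central_simple_algebra_def)
  let ?Z = "\<lambda>i. ring_center (A\<lparr>carrier := S i\<rparr>)"
  have MS: "M \<subseteq> S i" if "i \<le> k" for i
    using assms(8)[OF that] subfieldE(3) unfolding maximal_subfield_def by fastforce
  have FZ: "F \<subseteq> ?Z i" if "i \<le> k" for i
    using FM MS[OF that] center subringE(1)[OF assms(7)[OF that]] by (auto simp: ring_center_def)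
  have "\<exists>\<theta>. \<theta> \<in> ring_hom (A\<lparr>carrier := ?Z i\<rparr>) (A\<lparr>carrier := M\<rparr>) \<and> (\<forall>x\<in>F. \<theta> x = x) \<and>
          solvable (Gal A M (\<theta> ` ?Z i))" if "i \<le> k" for i
    using that
  proof (induction i)
    case 0
    have Z0: "?Z 0 = M"
      using subfieldE(4)[OF M] assms(4) by (auto simp: ring_center_def)
    have id: "(\<lambda>x. x) \<in> ring_hom (A\<lparr>carrier := M\<rparr>) (A\<lparr>carrier := M\<rparr>)"
      by (auto intro: ring_hom_memI)
    have "subgroup (carrier (Gal A M M)) (BijGroup M)"
      using ring.subfield_iff(2)[OF A M] by (intro subgroup_Gal) (auto simp: field_def domain_def cring_def)
    then have one: "\<one>\<^bsub>BijGroup M\<^esub> \<in> carrier (Gal A M M)"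
      by (rule subgroup.one_closed)
    have "\<sigma> = (\<lambda>x\<in>M. x)" if "\<sigma> \<in> carrier (Gal A M M)" for \<sigma>
      using that by (intro extensionalityI[of _ M]) (auto simp: carrier_Gal_iff Bij_def)
    then have "carrier (Gal A M M) = {\<one>\<^bsub>Gal A M M\<^esub>}"
      using one by (auto simp: Gal_def BijGroup_def)
    then have "solvable (Gal A M M)"
      using solvable_seq.unity by (simp add: solvable_def)
    then show ?case
      using id Z0 by (intro exI[of _ "\<lambda>x. x"]) simp
  next
    case (Suc i)
    then obtain \<theta> where "\<theta> \<in> ring_hom (A\<lparr>carrier := ?Z i\<rparr>) (A\<lparr>carrier := M\<rparr>)"
      and "\<And>x. x \<in> F \<Longrightarrow> \<theta> x = x" and "solvable (Gal A M (\<theta> ` ?Z i))"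
      by auto
    moreover have "i < k" "i \<le> k"
      using Suc.prems by auto
    ultimately show ?case
      using center_embedding_step[OF A M assms(7) prime_gt_1_nat[OF assms(9)] FZ assms(11,15,16)]
      by metis
  qed
  then obtain \<theta> where "\<And>x. x \<in> F \<Longrightarrow> \<theta> x = x" and "solvable (Gal A M (\<theta> ` ?Z k))"
    by blast
  moreover have "?Z k = F"
    using assms(5) center by (simp add: ring_center_def)
  ultimately show ?thesis
    by simp
qed

end
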